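(* Let $q$ be a power of a prime and let $F=\mathbb{F}_q(t)$ with $t$ transcendental over $\mathbb{F}_q$. Then the polynomial $x^{q^2-1}+tx^{q-1}+1\in F[x]$ has Galois group over $F$ isomorphic to $SL(2,q)$. *)

theory Defs
  imports "HOL-Analysis.Determinants" "HOL-Algebra.Algebraic_Closure_Type"
    "HOL-Computational_Algebra.Fraction_Field" "HOL-Computational_Algebra.Polynomial"
begin

definition is_subfield :: "'k::field set \<Rightarrow> bool" where
  "is_subfield S \<longleftrightarrow> 0 \<in> S \<and> 1 \<in> S \<and> (\<forall>x\<in>S. \<forall>y\<in>S. x + y \<in> S \<and> x * y \<in> S)
     \<and> (\<forall>x\<in>S. - x \<in> S \<and> inverse x \<in> S)"

definition roots_ac :: "'f::field poly \<Rightarrow> 'f alg_closure set" where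
  "roots_ac p = {x. poly (map_poly to_ac p) x = 0}"

definition splitting_field_ac :: "'f::field poly \<Rightarrow> 'f alg_closure set" where
  "splitting_field_ac p = \<Inter> {S. is_subfield S \<and> range to_ac \<subseteq> S \<and> roots_ac p \<subseteq> S}"

definition galois_group :: "'f::field poly \<Rightarrow> ('f alg_closure \<Rightarrow> 'f alg_closure) monoid" where
  "galois_group p =
    (let E = splitting_field_ac p in
     \<lparr> carrier = {\<sigma>. bij_betw \<sigma> E E
                   \<and> (\<forall>x\<in>E. \<forall>y\<in>E. \<sigma> (x + y) = \<sigma> x + \<sigma> y \<and> \<sigma> (x * y) = \<sigma> x * \<sigma> y)
                   \<and> \<sigma> 1 = 1
                   \<and> (\<forall>a. \<sigma> (to_ac a) = to_ac a)
                   \<and> (\<forall>x. x \<notin> E \<longrightarrow> \<sigma> x = undefined)},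
       mult = (\<lambda>\<sigma> \<tau>. restrict (\<sigma> \<circ> \<tau>) E),
       one = restrict id E \<rparr>)"

definition SL2 :: "('k::comm_ring_1 ^ 2 ^ 2) monoid" where
  "SL2 = \<lparr> carrier = {A. det A = 1}, mult = (\<lambda>A B. A ** B), one = mat 1 \<rparr>"

end

theory Submission
  imports Defs
begin

text \<open>
  The nonzero roots of \<open>x * f x = L x = x ^ q\<^sup>2 + T * x ^ q + x\<close> together with \<open>0\<close> form an
  \<open>\<bbbF>\<^sub>q\<close>-space. If \<open>u\<close>, \<open>v\<close> are roots, the Moore determinant \<open>W u v = u * v ^ q - u ^ q * v\<close>
  lies in \<open>\<bbbF>\<^sub>q\<close>, and automorphisms fix it while it changes by the determinant of their matrix:
  the Galois group embeds in \<open>SL(2,q)\<close>. Normalise a basis by \<open>W u v = 1\<close>. The splitting field is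
  \<open>\<bbbF>\<^sub>q(u, v)\<close>, because \<open>T\<close> can be solved from \<open>L u = 0\<close>. As \<open>u\<close> is transcendental and
  \<open>X * Y ^ q - X ^ q * Y - 1\<close> is irreducible over \<open>\<bbbF>\<^sub>q(X)\<close> (Eisenstein at \<open>X\<close>, reversing the roles of the
  leading and the constant coefficient in \<open>Y\<close>), this polynomial generates all relations between
  \<open>u\<close> and \<open>v\<close>. It is invariant under \<open>SL(2,q)\<close>, so every matrix of determinant \<open>1\<close> acts on
  \<open>\<bbbF>\<^sub>q(u, v)\<close>; it fixes \<open>T\<close> because all roots of \<open>L\<close> determine the same \<open>T\<close>.
\<close>

section \<open>Subfields, ring homomorphisms and evaluation of polynomials\<close>

lemma is_subfieldD:
  assumes "is_subfield S"
  shows "0 \<in> S" "1 \<in> S" "x \<in> S \<Longrightarrow> y \<in> S \<Longrightarrow> x + y \<in> S" "x \<in> S \<Longrightarrow> y \<in> S \<Longrightarrow> x * y \<in> S"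
    "x \<in> S \<Longrightarrow> - x \<in> S" "x \<in> S \<Longrightarrow> inverse x \<in> S" "x \<in> S \<Longrightarrow> y \<in> S \<Longrightarrow> x / y \<in> S"
    "x \<in> S \<Longrightarrow> x ^ n \<in> S"
proof -
  show mult: "x * y \<in> S" if "x \<in> S" "y \<in> S" for x y
    using assms that by (simp add: is_subfield_def)
  show "x / y \<in> S" if "x \<in> S" "y \<in> S"
    using assms that mult by (simp add: is_subfield_def divide_inverse)
  show "x ^ n \<in> S" if "x \<in> S"
    using that assms by (induction n) (auto intro: mult simp: is_subfield_def)
qed (use assms in \<open>auto simp: is_subfield_def\<close>)

text \<open>Evaluation \<open>ev x\<close> of polynomials along such a map is again such a map.
  Iterating it evaluates polynomials in two variables, and every fact below is available at both
  levels.\<close>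

locale unital_hom =
  fixes h :: "'r::comm_ring_1 \<Rightarrow> 's::comm_ring_1"
  assumes hom_add: "h (x + y) = h x + h y"
    and hom_mult: "h (x * y) = h x * h y"
    and hom_one [simp]: "h 1 = 1"
begin

lemma hom_zero [simp]: "h 0 = 0"
  using hom_add[of 0 0] by simp

lemma hom_uminus: "h (- x) = - h x"
  using hom_add[of x "- x"] by (simp add: minus_unique)

lemma hom_diff: "h (x - y) = h x - h y"
  using hom_add[of x "- y"] by (simp add: hom_uminus)

lemma hom_power: "h (x ^ n) = h x ^ n"
  by (induction n) (simp_all add: hom_mult)

lemma hom_of_nat: "h (of_nat n) = of_nat n"
  by (induction n) (simp_all add: hom_add)

definition ev :: "'s \<Rightarrow> 'r poly \<Rightarrow> 's" where
  "ev x p = poly (map_poly h p) x"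

lemma ev_0 [simp]: "ev x 0 = 0"
  by (simp add: ev_def)

lemma ev_pCons [simp]: "ev x (pCons a p) = h a + x * ev x p"
  by (simp add: ev_def map_poly_pCons)

lemma map_poly_add: "map_poly h (p + r) = map_poly h p + map_poly h r"
  by (intro poly_eqI) (simp add: coeff_map_poly hom_add)

lemma map_poly_mult: "map_poly h (p * r) = map_poly h p * map_poly h r"
  by (induction p) (simp_all add: map_poly_add map_poly_smult map_poly_pCons hom_mult)

lemma ev_add: "ev x (p + r) = ev x p + ev x r"
  by (simp add: ev_def map_poly_add)

lemma ev_mult: "ev x (p * r) = ev x p * ev x r"
  by (simp add: ev_def map_poly_mult)

lemma ev_smult: "ev x (smult a p) = h a * ev x p"
  by (simp add: ev_def map_poly_smult hom_mult)

lemma ev_1 [simp]: "ev x 1 = 1"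
  by (simp add: one_pCons)

lemma ev_monom: "ev x (monom a n) = h a * x ^ n"
  by (simp add: ev_def map_poly_monom poly_monom)

lemma unital_hom_ev: "unital_hom (ev x)"
  by unfold_locales (simp_all add: ev_add ev_mult)

lemma ev_in_subring:
  assumes "\<And>a. h a \<in> S" "x \<in> S" "\<And>y z. y \<in> S \<Longrightarrow> z \<in> S \<Longrightarrow> y + z \<in> S \<and> y * z \<in> S"
  shows "ev x p \<in> S"
proof (induction p)
  case 0
  then show ?case
    using assms(1)[of 0] by simp
next
  case (pCons a p)
  then show ?case
    using assms by simp
qed

text \<open>Induction along the coefficients, with \<open>S\<close> guaranteeing that all
  intermediate values stay where \<open>\<sigma>\<close> is multiplicative and additive: Galois
  automorphisms are \<open>undefined\<close> outside their field. The map \<open>h'\<close> may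
  differ from \<open>h\<close> because at the second level the inner evaluation point moves
  too.\<close>

lemma ev_commute:
  assumes "unital_hom h'" "\<And>a. \<sigma> (h a) = h' a"
    and "\<And>a. h a \<in> S" "x \<in> S"
    and "\<And>y z. y \<in> S \<Longrightarrow> z \<in> S \<Longrightarrow> y + z \<in> S \<and> y * z \<in> S"
    and "\<And>y z. y \<in> S \<Longrightarrow> z \<in> S \<Longrightarrow> \<sigma> (y + z) = \<sigma> y + \<sigma> z \<and> \<sigma> (y * z) = \<sigma> y * \<sigma> z"
  shows "\<sigma> (ev x p) = unital_hom.ev h' (\<sigma> x) p"
proof -
  interpret h': unital_hom h' by fact
  show ?thesis
  proof (induction p)
    case 0
    show ?case
      using assms(2)[of 0] by simp
  next
    case (pCons a p)
    have "ev x p \<in> S"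
      using assms(3-5) by (rule ev_in_subring)
    then show ?case
      using pCons assms by simp
  qed
qed

end

lemma unital_hom_field_inj:
  fixes h :: "'r::field \<Rightarrow> 's::field"
  assumes "unital_hom h"
  shows "inj h"
proof (rule injI)
  interpret unital_hom h by fact
  fix x y assume "h x = h y"
  then have 0: "h (x - y) = 0"
    by (simp add: hom_diff)
  show "x = y"
  proof (rule ccontr)
    assume "x \<noteq> y"
    then have "h ((x - y) * inverse (x - y)) = 1"
      by simp
    then show False
      using 0 by (simp only: hom_mult) simp
  qed
qed

section \<open>Finite fields and the Frobenius map\<close>

text \<open>Multiplication by a nonzero \<open>x\<close> permutes the nonzero elements; comparing
  the products of all of them gives \<open>x ^ (q - 1) = 1\<close>.\<close>

lemma finite_field_power_card:
  fixes x :: "'a::{finite,field}"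
  shows "x ^ CARD('a) = x"
proof (cases "x = 0")
  case False
  have "bij_betw ((*) x) (UNIV - {0}) (UNIV - {0})"
    by (rule bij_betwI[of _ _ _ "\<lambda>y. y / x"]) (use False in auto)
  then have "(\<Prod>y\<in>UNIV - {0}. x * y) = \<Prod>(UNIV - {0})"
    by (rule prod.reindex_bij_betw)
  then have "x ^ (CARD('a) - 1) = 1"
    by (simp add: prod.distrib)
  then show ?thesis
    by (metis Suc_diff_1 mult.right_neutral power_Suc zero_less_card_finite)
qed (simp add: card_eq_0_iff)

lemma card_field_ge_2: "CARD('a::{finite,field}) \<ge> 2"
proof -
  have "card {0, 1 :: 'a} \<le> CARD('a)"
    by (rule card_mono) auto
  then show ?thesis
    by simp
qed

lemma poly_eq_0_if_vanishes:
  fixes p :: "'a::{finite,field} poly"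
  assumes "\<And>x. poly p x = 0" "degree p < CARD('a)"
  shows "p = 0"
proof (rule ccontr)
  assume "p \<noteq> 0"
  then have "card {x. poly p x = 0} \<le> degree p"
    by (rule card_poly_roots_bound)
  with assms show False
    by simp
qed

text \<open>The polynomial \<open>(1 + X) ^ q - X ^ q - 1\<close> vanishes at all \<open>q\<close>
  points of the field, and its degree is below \<open>q\<close> since the leading terms cancel.
  Hence it is zero, and its coefficients are these binomials. No prime power form of
  \<open>q\<close> enters.\<close>

lemma of_nat_choose_card_eq_0:
  assumes "0 < k" "k < CARD('a::{finite,field})"
  shows "of_nat (CARD('a) choose k) = (0 :: 'a)"
proof -
  let ?q = "CARD('a)"
  define p :: "'a poly" where "p = [:1, 1:] ^ ?q - monom 1 ?q - 1"
  have q: "?q \<ge> 2"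
    by (rule card_field_ge_2)
  have "p = 0"
  proof (rule poly_eq_0_if_vanishes)
    show "poly p x = 0" for x
      by (simp add: p_def poly_monom finite_field_power_card)
    have 1: "coeff ([:1, 1:] ^ ?q :: 'a poly) ?q = 1"
      by (subst coeff_linear_poly_power) auto
    have "degree ([:1, 1:] ^ ?q :: 'a poly) = ?q"
      by (simp add: degree_power_eq)
    then have "degree p \<le> ?q"
      unfolding p_def by (intro degree_diff_le) (auto simp: degree_monom_eq)
    moreover have "coeff p ?q = 0"
      using q 1 by (simp add: p_def)
    ultimately show "degree p < ?q"
      using q by (metis coeff_0 degree_0 le_neq_implies_less leading_coeff_0_iff
        less_le_trans zero_less_numeral)
  qed
  then have "coeff p k = 0"
    by simp
  then show ?thesis
    using assms by (simp add: p_def coeff_linear_poly_power)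
qed

locale finite_field_extension = unital_hom \<iota>
  for \<iota> :: "'a::{finite,field} \<Rightarrow> 'k::field" +
  fixes q :: nat
  assumes q_eq: "q = CARD('a)"
begin

lemma q_ge_2: "q \<ge> 2"
  unfolding q_eq by (rule card_field_ge_2)

lemma inj_\<iota>: "inj \<iota>"
  by (rule unital_hom_field_inj) unfold_locales

lemma \<iota>_power_q [simp]: "\<iota> a ^ q = \<iota> a"
  by (metis finite_field_power_card hom_power q_eq)

lemma power_q_add: "(x + y :: 'k) ^ q = x ^ q + y ^ q"
proof -
  have "(x + y) ^ q = (\<Sum>k\<le>q. of_nat (q choose k) * x ^ k * y ^ (q - k))"
    by (rule binomial_ring)
  also have "\<dots> = (\<Sum>k\<in>{0, q}. of_nat (q choose k) * x ^ k * y ^ (q - k))"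
  proof (intro sum.mono_neutral_right ballI)
    fix k assume "k \<in> {..q} - {0, q}"
    \<comment> \<open>The binomials vanish in the finite field, and \<iota> carries this over to the
      extension.\<close>
    then have "of_nat (q choose k) = (0 :: 'a)"
      unfolding q_eq by (intro of_nat_choose_card_eq_0) auto
    then have "of_nat (q choose k) = (0 :: 'k)"
      by (metis hom_of_nat hom_zero)
    then show "of_nat (q choose k) * x ^ k * y ^ (q - k) = 0"
      by simp
  qed auto
  finally show ?thesis
    using q_ge_2 by (simp add: add_ac)
qed

text \<open>Derived from additivity, so that even and odd \<open>q\<close> are treated
  alike.\<close>

lemma power_q_uminus: "(- x :: 'k) ^ q = - (x ^ q)"
proof -
  have "(- x) ^ q + x ^ q = 0"
    using power_q_add[of "- x" x] q_ge_2 by (simp add: power_0_left)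
  then show ?thesis
    by (simp add: eq_neg_iff_add_eq_0)
qed

lemma power_q_diff: "(x - y :: 'k) ^ q = x ^ q - y ^ q"
  using power_q_add[of x "- y"] by (simp add: power_q_uminus)

text \<open>\<open>X ^ q - X\<close> has at most \<open>q\<close> roots, and the range of \<iota>
  already supplies \<open>q\<close> of them.\<close>

lemma fixed_by_power_q:
  assumes "x ^ q = x"
  obtains a where "x = \<iota> a"
proof -
  define p :: "'k poly" where "p = monom 1 q - monom 1 1"
  have "coeff p q = 1"
    using q_ge_2 by (simp add: p_def)
  then have "p \<noteq> 0"
    by auto
  have "degree p \<le> q"
    unfolding p_def using q_ge_2 by (intro degree_diff_le) (auto simp: degree_monom_eq)
  with \<open>p \<noteq> 0\<close> have "card {x. poly p x = 0} \<le> q"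
    using card_poly_roots_bound le_trans by blast
  moreover have "range \<iota> \<subseteq> {x. poly p x = 0}"
    by (auto simp: p_def poly_monom)
  moreover have "card (range \<iota>) = q"
    by (simp add: card_image inj_\<iota> q_eq)
  moreover have "finite {x. poly p x = 0}"
    using \<open>p \<noteq> 0\<close> by (rule poly_roots_finite)
  ultimately have "range \<iota> = {x. poly p x = 0}"
    by (intro card_seteq) auto
  then show ?thesis
    using that assms by (auto simp: p_def poly_monom)
qed

definition W :: "'k \<Rightarrow> 'k \<Rightarrow> 'k" where
  "W x y = x * y ^ q - x ^ q * y"

lemma W_add_right: "W x (y + z) = W x y + W x z"
  by (simp add: W_def power_q_add algebra_simps)

lemma W_scale_right: "W x (\<iota> a * y) = \<iota> a * W x y"
  by (simp add: W_def power_mult_distrib algebra_simps)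

lemma W_swap: "W y x = - W x y"
  by (simp add: W_def algebra_simps)

lemma W_self [simp]: "W x x = 0"
  by (simp add: W_def)

lemma W_add_left: "W (x + y) z = W x z + W y z"
  by (metis W_add_right W_swap minus_add_distrib)

lemma W_scale_left: "W (\<iota> a * x) y = \<iota> a * W x y"
  by (metis W_scale_right W_swap mult_minus_right)

text \<open>A vanishing Moore determinant means linear dependence: it says that \<open>y / x\<close>
  is fixed by the \<open>q\<close>-th power map.\<close>

lemma W_eq_0:
  assumes "W x y = 0" "x \<noteq> 0"
  obtains a where "y = \<iota> a * x"
proof -
  have "(y / x) ^ q = y / x"
    using assms by (simp add: W_def power_divide field_simps)
  then show ?thesis
    using fixed_by_power_q that assms(2) by (metis nonzero_eq_divide_eq)
qed

end

section \<open>Polynomials over finite fields and factors of the Moore polynomial\<close>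

lemma finite_polys_degree_le: "finite {p :: 'a::{finite,zero} poly. degree p \<le> n}"
proof (rule finite_subset)
  show "{p. degree p \<le> n} \<subseteq> Poly ` {xs :: 'a list. set xs \<subseteq> UNIV \<and> length xs \<le> Suc n}"
  proof
    fix p :: "'a poly" assume "p \<in> {p. degree p \<le> n}"
    then have "length (coeffs p) \<le> Suc n"
      by (cases "p = 0") (simp_all add: length_coeffs)
    then show "p \<in> Poly ` {xs. set xs \<subseteq> UNIV \<and> length xs \<le> Suc n}"
      by (intro image_eqI[of _ _ "coeffs p"]) simp_all
  qed
  show "finite (Poly ` {xs :: 'a list. set xs \<subseteq> UNIV \<and> length xs \<le> Suc n})"
    by (intro finite_imageI finite_lists_length_le) simp
qed

text \<open>The outer variable is \<open>Y\<close> and the inner one is \<open>X\<close>; this is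
  \<open>X * Y ^ n - X ^ n * Y - 1\<close>.\<close>

definition moore_poly :: "nat \<Rightarrow> 'a::field poly poly" where
  "moore_poly n = monom [:0, 1:] n - monom (monom 1 n) 1 - 1"

lemma
  assumes "n \<ge> 2"
  shows degree_moore_poly: "degree (moore_poly n :: 'a::field poly poly) = n"
    and lead_coeff_moore_poly: "lead_coeff (moore_poly n :: 'a::field poly poly) = [:0, 1:]"
proof -
  let ?M = "moore_poly n :: 'a poly poly"
  have c: "coeff ?M n = [:0, 1:]"
    using assms by (simp add: moore_poly_def)
  have "degree ?M \<le> n"
    unfolding moore_poly_def using assms
    by (intro degree_diff_le) (auto intro: order.trans[OF degree_monom_le])
  moreover have "n \<le> degree ?M"
    by (rule le_degree) (simp add: c)
  ultimately show "degree ?M = n"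
    by simp
  with c show "lead_coeff ?M = [:0, 1:]"
    by simp
qed

text \<open>Irreducibility over the field of fractions, with \<open>a\<close> clearing denominators.
  Modulo \<open>X\<close> the Moore polynomial is \<open>- 1\<close>. If \<open>X\<close> divides
  \<open>a\<close>, it divides \<open>D\<close> or \<open>Q\<close> and can be cancelled, which
  lowers the degree of \<open>a\<close>. Otherwise both reductions are nonzero constants; if
  \<open>D\<close> and \<open>Q\<close> had positive degree, \<open>X\<close> would divide both
  leading coefficients, so \<open>X ^ 2\<close> would divide \<open>a * X\<close>.\<close>

lemma moore_poly_factors:
  fixes a :: "'a::field poly"
  assumes "n \<ge> 2" "a \<noteq> 0" "smult a (moore_poly n) = D * Q"
  shows "degree D = 0 \<or> degree Q = 0"
  using assms(2,3)
proof (induction "degree a" arbitrary: a D Q rule: less_induct)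
  case less
  let ?M = "moore_poly n :: 'a poly poly"
  interpret unital_hom "\<lambda>p :: 'a poly. poly p 0"
    by unfold_locales simp_all
  let ?X = "[:0, 1:] :: 'a poly"
  define red where "red = map_poly (\<lambda>p :: 'a poly. poly p 0)"
  have X_dvd: "?X dvd c \<longleftrightarrow> poly c 0 = 0" for c
    by (simp add: dvd_iff_poly_eq_0)
  have coeff_red: "coeff (red P) i = poly (coeff P i) 0" for P i
    by (simp add: red_def coeff_map_poly)
  have red_eq_0: "\<exists>P'. P = smult ?X P'" if "red P = 0" for P
  proof -
    have "[:?X:] dvd P"
      unfolding const_poly_dvd_iff X_dvd using that coeff_red by (metis coeff_0)
    then show ?thesis
      by (auto elim!: dvdE)
  qed
  have smult_cancel_X: "A = B" if "smult ?X A = smult ?X B" for A B :: "'a poly poly"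
  proof -
    have "smult ?X (A - B) = 0"
      using that by (simp only: smult_diff_right) simp
    then show ?thesis
      by (simp only: smult_eq_0_iff) simp
  qed
  have red_M: "red ?M = - 1"
    using assms(1)
    by (intro poly_eqI) (auto simp: coeff_red moore_poly_def coeff_pCons one_pCons poly_monom split: nat.splits)
  have prod: "smult (poly a 0) (- 1) = red D * red Q"
    using less.prems(2) unfolding red_M[symmetric] red_def
    by (metis hom_mult hom_zero map_poly_mult map_poly_smult)
  show ?case
  proof (cases "poly a 0 = 0")
    case True
    then obtain a' where a': "a = ?X * a'"
      using X_dvd[of a] unfolding dvd_def by blast
    with less.prems(1) have "a' \<noteq> 0" by auto
    have "degree a' < degree a"
      using \<open>a' \<noteq> 0\<close> unfolding a' by simp
    note IH = less.hyps[OF this \<open>a' \<noteq> 0\<close>]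
    have "red D = 0 \<or> red Q = 0"
      using prod True by auto
    then show ?thesis
    proof
      assume "red D = 0"
      then obtain D' where D': "D = smult ?X D'"
        using red_eq_0 by blast
      have "smult ?X (smult a' ?M) = smult ?X (D' * Q)"
        using less.prems(2) by (simp add: a' D')
      then have "smult a' ?M = D' * Q"
        by (rule smult_cancel_X)
      from IH[OF this] show ?thesis
        by (auto simp: D')
    next
      assume "red Q = 0"
      then obtain Q' where Q': "Q = smult ?X Q'"
        using red_eq_0 by blast
      have "smult ?X (smult a' ?M) = smult ?X (D * Q')"
        using less.prems(2) by (simp add: a' Q')
      then have "smult a' ?M = D * Q'"
        by (rule smult_cancel_X)
      from IH[OF this] show ?thesis
        by (auto simp: Q')
    qed
  next
    case False
    show ?thesis
    proof (rule ccontr)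
      assume *: "\<not> ?thesis"
      from False have ne: "red D * red Q \<noteq> 0"
        by (simp flip: prod)
      have "degree (red D * red Q) = 0"
        by (simp flip: prod)
      then have "degree (red D) = 0" "degree (red Q) = 0"
        using ne by (auto simp: degree_mult_eq)
      with * have "coeff (red D) (degree D) = 0" "coeff (red Q) (degree Q) = 0"
        by (auto intro: coeff_eq_0)
      then obtain d e where "lead_coeff D = ?X * d" "lead_coeff Q = ?X * e"
        unfolding coeff_red X_dvd[symmetric] by (auto elim!: dvdE)
      moreover have "a * ?X = lead_coeff D * lead_coeff Q"
        using less.prems(2) lead_coeff_moore_poly[OF assms(1), where 'a = 'a]
        by (metis lead_coeff_mult lead_coeff_smult)
      ultimately have "?X * a = ?X * (?X * (d * e))"
        by (simp only: ac_simps)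
      then have "a = ?X * (d * e)"
        by (subst (asm) mult_cancel_left) simp
      with False show False
        by simp
    qed
  qed
qed

section \<open>The additive polynomial and the relations between its roots\<close>

locale dickson = finite_field_extension \<iota> q
  for \<iota> :: "'a::{finite,field} \<Rightarrow> 'k::field" and q +
  fixes T :: 'k
  assumes transcendental_T: "ev T p = 0 \<Longrightarrow> p = 0"
begin

sublocale ev: unital_hom "ev x" for x
  by (rule unital_hom_ev)

text \<open>The first argument is substituted for the inner variable \<open>X\<close>, the second
  for the outer variable \<open>Y\<close>.\<close>

abbreviation ev2 :: "'k \<Rightarrow> 'k \<Rightarrow> 'a poly poly \<Rightarrow> 'k" where
  "ev2 \<equiv> ev.ev"

definition L :: "'k \<Rightarrow> 'k" where
  "L x = x ^ (q ^ 2) + T * x ^ q + x"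

text \<open>Such pairs are the normalised bases of the root space; \<open>L v = 0\<close> follows
  through \<open>W_Frobenius\<close>.\<close>

definition good :: "'k \<Rightarrow> 'k \<Rightarrow> bool" where
  "good u v \<longleftrightarrow> u \<noteq> 0 \<and> L u = 0 \<and> W u v = 1"

lemma ev2_moore_poly: "ev2 u v (moore_poly q) = W u v - 1"
proof -
  interpret e: unital_hom "ev2 u v"
    by (rule ev.unital_hom_ev)
  show ?thesis
    by (simp add: moore_poly_def e.hom_diff ev.ev_monom ev_monom W_def)
qed

text \<open>If \<open>u\<close> were algebraic, the ring it generates would be finite and contain \<open>1 / u\<close>,
  hence \<open>T\<close> and all of its powers.\<close>

lemma transcendental_root:
  assumes "L u = 0" "u \<noteq> 0" "ev u p = 0"
  shows "p = 0"
proof (rule ccontr)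
  assume "p \<noteq> 0"
  define A where "A = range (ev u)"
  have "A \<subseteq> ev u ` {r. degree r \<le> degree p}"
  proof
    fix x assume "x \<in> A"
    then obtain r where r: "x = ev u r"
      by (auto simp: A_def)
    \<comment> \<open>Division with remainder by \<open>p\<close> represents every element of
      \<open>A\<close> by a polynomial of bounded degree.\<close>
    have "ev u (p * (r div p) + r mod p) = ev u (r mod p)"
      unfolding ev_add ev_mult assms by simp
    then have "x = ev u (r mod p)"
      by (simp add: r)
    moreover have "degree (r mod p) \<le> degree p"
      by (metis \<open>p \<noteq> 0\<close> degree_0 degree_mod_less le0 less_imp_le)
    ultimately show "x \<in> ev u ` {r. degree r \<le> degree p}"
      by auto
  qed
  then have fin: "finite A"
    using finite_subset finite_polys_degree_le by blast
  have A_add: "x + y \<in> A" and A_mult: "x * y \<in> A"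
    if "x \<in> A" "y \<in> A" for x y
    using that unfolding A_def by (auto simp flip: ev.hom_add ev.hom_mult)
  have A_uminus: "- x \<in> A" if "x \<in> A" for x
    using that unfolding A_def by (auto simp flip: ev.hom_uminus)
  have "1 \<in> A"
    unfolding A_def by (metis ev_1 rangeI)
  then have A_power: "x ^ n \<in> A" if "x \<in> A" for x n
    by (induction n) (auto intro: A_mult that)
  have "ev u [:0, 1:] = u"
    by simp
  then have u: "u \<in> A"
    unfolding A_def by (metis rangeI)
  have no_inj: "\<not> inj (\<lambda>n. x ^ n)" if "x \<in> A" for x
  proof
    assume "inj (\<lambda>n. x ^ n)"
    then have "infinite (range (\<lambda>n. x ^ n))"
      by (simp add: finite_image_iff)
    moreover have "range (\<lambda>n. x ^ n) \<subseteq> A"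
      using A_power that by auto
    ultimately show False
      using fin finite_subset by blast
  qed
  \<comment> \<open>In the finite ring two powers of \<open>u\<close> coincide; cancelling the
    smaller one exhibits \<open>inverse u\<close> as a power of \<open>u\<close>.\<close>
  obtain i j where ij: "i < j" "u ^ i = u ^ j"
    using no_inj[OF u] unfolding inj_def by (metis linorder_neqE_nat)
  have "u ^ j = u ^ i * (u * u ^ (j - i - 1))"
    using ij(1) by (simp flip: power_Suc power_add)
  then have "u * u ^ (j - i - 1) = 1"
    using ij(2) assms(2) by simp
  then have "inverse u = u ^ (j - i - 1)"
    by (simp add: inverse_unique)
  then have inv: "inverse u \<in> A"
    using A_power u by simp
  have "T = - (u ^ (q ^ 2) + u) * inverse u ^ q"
    using assms(1,2) by (simp add: L_def field_simps eq_neg_iff_add_eq_0)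
  then have "T \<in> A"
    by (simp only:) (intro A_add A_mult A_uminus A_power u inv)
  moreover have "inj (\<lambda>n. T ^ n)"
  proof (rule injI)
    fix m n assume "T ^ m = T ^ n"
    then have "ev T (monom 1 m - monom 1 n) = 0"
      by (simp add: ev.hom_diff ev_monom)
    then have "monom (1::'a) m - monom 1 n = 0"
      by (rule transcendental_T)
    then show "m = n"
      by (simp add: monom_eq_iff')
  qed
  ultimately show False
    using no_inj by blast
qed

text \<open>A relation \<open>D\<close> of least degree in \<open>Y\<close> divides the Moore
  polynomial up to a factor in \<open>X\<close>, since the remainder is again a relation. The
  factorisation lemma then makes the cofactor constant in \<open>Y\<close>, so \<open>D\<close> has
  degree \<open>q\<close>.\<close>

lemma ev2_eq_0_low_degree:
  assumes good: "good u v" and "ev2 u v P = 0" "degree P < q"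
  shows "P = 0"
proof (rule ccontr)
  interpret e: unital_hom "ev2 u v"
    by (rule ev.unital_hom_ev)
  assume "P \<noteq> 0"
  with assms(2) obtain D where D: "D \<noteq> 0" "ev2 u v D = 0"
    and min: "\<And>R. R \<noteq> 0 \<Longrightarrow> ev2 u v R = 0 \<Longrightarrow> degree D \<le> degree R"
    using ex_has_least_nat[of "\<lambda>D. D \<noteq> 0 \<and> ev2 u v D = 0" P degree] by blast
  have "degree D < q"
    using min[OF \<open>P \<noteq> 0\<close>] assms by simp
  \<comment> \<open>A relation constant in \<open>Y\<close> would be an algebraic equation for
    \<open>u\<close> alone.\<close>
  have "degree D \<noteq> 0"
  proof
    assume "degree D = 0"
    then obtain c where "D = [:c:]"
      by (rule degree_eq_zeroE)
    with D transcendental_root good show False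
      by (auto simp: good_def)
  qed
  \<comment> \<open>Coefficients lie in a polynomial ring, so only pseudo-division is available;
    this is the origin of the multiplier \<open>a\<close>.\<close>
  from pseudo_mod[OF D(1), of "moore_poly q"] obtain a Q r
    where a: "a \<noteq> 0" and eq: "smult a (moore_poly q) = D * Q + r"
      and r: "r = 0 \<or> degree r < degree D"
    by blast
  have "ev2 u v (D * Q + r) = 0"
    using good by (simp add: ev.ev_smult ev2_moore_poly good_def flip: eq)
  then have "ev2 u v r = 0"
    by (simp add: e.hom_add e.hom_mult D)
  with r min have "r = 0"
    by force
  with eq have eq: "smult a (moore_poly q) = D * Q"
    by simp
  from moore_poly_factors[OF q_ge_2 a eq] \<open>degree D \<noteq> 0\<close> have "degree Q = 0"
    by simp
  moreover have "degree (D * Q) = q"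
    using a by (simp add: degree_moore_poly q_ge_2 flip: eq)
  moreover from this have "D * Q \<noteq> 0"
    using q_ge_2 by auto
  ultimately show False
    using \<open>degree D < q\<close> by (simp add: degree_mult_eq)
qed

text \<open>Up to a nonzero factor in \<open>X\<close>, every relation is a multiple of the Moore
  polynomial, which vanishes at all good pairs. The factor itself does not vanish, as
  \<open>u'\<close> is transcendental.\<close>

lemma ev2_eq_0_transfer:
  assumes "good u v" "good u' v'" "ev2 u v P = 0"
  shows "ev2 u' v' P = 0"
proof -
  have M: "moore_poly q \<noteq> (0 :: 'a poly poly)"
    using degree_moore_poly[OF q_ge_2, where 'a = 'a] q_ge_2 by auto
  from pseudo_mod[OF this, of P] obtain a Q r
    where a: "a \<noteq> 0" and eq: "smult a P = moore_poly q * Q + r"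
      and r: "r = 0 \<or> degree r < degree (moore_poly q :: 'a poly poly)"
    by blast
  have "ev u a * ev2 u v P = ev2 u v r" if "good u v" for u v
    using that arg_cong[OF eq, of "ev2 u v"]
    by (simp add: ev.ev_smult ev.ev_add ev.ev_mult ev2_moore_poly good_def)
  note * = this
  from *[OF assms(1)] assms(3) have "ev2 u v r = 0"
    by simp
  with ev2_eq_0_low_degree[OF assms(1)] r have "r = 0"
    by (auto simp: degree_moore_poly q_ge_2)
  with *[OF assms(2)] have "ev u' a * ev2 u' v' P = 0"
    by simp
  moreover have "ev u' a \<noteq> 0"
    using transcendental_root a assms(2) unfolding good_def by blast
  ultimately show ?thesis
    by simp
qed

text \<open>For a fixed nonzero root \<open>u\<close>, this turns \<open>L x = 0\<close> into the
  condition that \<open>W u x\<close> lies in the finite field.\<close>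

lemma W_Frobenius:
  assumes "L u = 0"
  shows "W u x ^ q - W u x = u ^ q * L x"
proof -
  have q2: "(y ^ q) ^ q = y ^ (q ^ 2)" for y :: 'k
    by (simp add: power2_eq_square flip: power_mult)
  have u: "u ^ (q ^ 2) = - (T * u ^ q + u)"
    using assms by (simp only: L_def eq_neg_iff_add_eq_0 add.assoc)
  show ?thesis
    by (simp add: W_def power_q_diff power_mult_distrib q2 u L_def algebra_simps)
qed

lemma root_iff:
  assumes "x \<noteq> 0"
  shows "x ^ (q ^ 2 - 1) + T * x ^ (q - 1) + 1 = 0 \<longleftrightarrow> L x = 0"
proof -
  have "x * x ^ (n - 1) = x ^ n" if "n > 0" for n
    using that by (cases n) simp_all
  from this[of q] this[of "q ^ 2"] have "L x = x * (x ^ (q ^ 2 - 1) + T * x ^ (q - 1) + 1)"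
    using q_ge_2 by (simp add: L_def algebra_simps)
  with assms show ?thesis
    by simp
qed

end

section \<open>Bases of the root space and the field they generate\<close>

text \<open>The basis is a parameter so that all results can also be read in a second good pair, as
  changes of basis require.\<close>

locale dickson_basis = dickson \<iota> q T
  for \<iota> :: "'a::{finite,field} \<Rightarrow> 'k::field" and q T +
  fixes u v :: 'k
  assumes good: "good u v"
begin

lemma u_nonzero: "u \<noteq> 0" and L_u: "L u = 0" and W_u_v: "W u v = 1"
  using good by (auto simp: good_def)

definition lin :: "'a \<Rightarrow> 'a \<Rightarrow> 'k" where
  "lin a b = \<iota> a * u + \<iota> b * v"

lemma W_u_lin: "W u (lin a b) = \<iota> b"
  by (simp add: lin_def W_add_right W_scale_right W_u_v)

lemma W_lin_v: "W (lin a b) v = \<iota> a"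
  by (simp add: lin_def W_add_left W_scale_left W_u_v)

lemma W_lin_lin: "W (lin a b) (lin c d) = \<iota> (a * d - b * c)"
proof -
  have "W v u = - 1"
    using W_swap[of v u] W_u_v by simp
  then show ?thesis
    by (simp add: lin_def W_add_left W_add_right W_scale_left W_scale_right W_u_v
      hom_diff hom_mult)
qed

lemma lin_0_1: "lin 0 1 = v"
  by (simp add: lin_def)

text \<open>If \<open>x\<close> is a root, \<open>W u x\<close> is some \<open>\<iota> b\<close>.
  Then \<open>W u (x - \<iota> b * v) = 0\<close>, which makes the difference a multiple of
  \<open>u\<close>.\<close>

lemma L_eq_0_iff: "L x = 0 \<longleftrightarrow> (\<exists>a b. x = lin a b)"
proof -
  have *: "L x = 0 \<longleftrightarrow> W u x ^ q = W u x" for x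
    using W_Frobenius[OF L_u, of x] u_nonzero by (metis diff_eq_eq add.left_neutral mult_eq_0_iff power_not_zero)
  show ?thesis
  proof
    assume "L x = 0"
    then obtain b where b: "W u x = \<iota> b"
      using * fixed_by_power_q by metis
    have "W u (\<iota> (- b) * v) = - \<iota> b"
      using W_scale_right[of u "- b" v] by (simp add: W_u_v hom_uminus)
    then have "W u (x + \<iota> (- b) * v) = 0"
      by (simp add: W_add_right b)
    then obtain a where "x + \<iota> (- b) * v = \<iota> a * u"
      using W_eq_0 u_nonzero by metis
    then have "x = lin a b"
      by (simp add: lin_def hom_uminus algebra_simps)
    then show "\<exists>a b. x = lin a b"
      by blast
  next
    assume "\<exists>a b. x = lin a b"
    then show "L x = 0"
      by (auto simp: * W_u_lin)
  qed
qed

text \<open>The determinant of the coefficients is the Moore determinant of the new pair, because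
  \<open>W u v = 1\<close>.\<close>

lemma good_iff:
  "good x y \<longleftrightarrow> (\<exists>a b c d. x = lin a b \<and> y = lin c d \<and> a * d - b * c = 1)"
proof
  assume xy: "good x y"
  then obtain a b where x: "x = lin a b"
    using L_eq_0_iff good_def by blast
  have "x ^ q * L y = 0"
    using xy W_Frobenius[of x y] by (simp add: good_def)
  then have "L y = 0"
    using xy by (simp add: good_def)
  then obtain c d where y: "y = lin c d"
    using L_eq_0_iff by blast
  have "\<iota> (a * d - b * c) = \<iota> 1"
    using xy by (simp add: good_def x y W_lin_lin)
  then have "a * d - b * c = 1"
    using inj_\<iota> by (metis injD)
  with x y show "\<exists>a b c d. x = lin a b \<and> y = lin c d \<and> a * d - b * c = 1"
    by blast
next
  assume "\<exists>a b c d. x = lin a b \<and> y = lin c d \<and> a * d - b * c = 1"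
  then obtain a b c d where *: "x = lin a b" "y = lin c d" "a * d - b * c = 1"
    by blast
  then have "W x y = 1"
    by (simp add: W_lin_lin)
  moreover from this have "x \<noteq> 0"
    using q_ge_2 by (auto simp: W_def power_0_left)
  ultimately show "good x y"
    using * L_eq_0_iff by (auto simp: good_def)
qed

text \<open>The field generated by \<open>u\<close> and \<open>v\<close> over the finite field,
  given by explicit fractions so that substitution can act on numerator and denominator.\<close>

definition E :: "'k set" where
  "E = {ev2 u v P / ev2 u v Q | P Q. ev2 u v Q \<noteq> 0}"

lemma E_cases:
  assumes "x \<in> E"
  obtains P Q where "x = ev2 u v P / ev2 u v Q" "ev2 u v Q \<noteq> 0"
  using assms by (auto simp: E_def)

lemma frac_in_E: "ev2 u v Q \<noteq> 0 \<Longrightarrow> ev2 u v P / ev2 u v Q \<in> E"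
  by (auto simp: E_def)

lemma ev2_in_E: "ev2 u v P \<in> E"
  using frac_in_E[of 1 P] by simp

lemma \<iota>_in_E: "\<iota> a \<in> E"
  using ev2_in_E[of "[:[:a:]:]"] by simp

lemma u_in_E: "u \<in> E"
  using ev2_in_E[of "[:[:0, 1:]:]"] by simp

lemma v_in_E: "v \<in> E"
  using ev2_in_E[of "[:0, 1:]"] by simp

lemma is_subfield_E: "is_subfield E"
proof -
  interpret e: unital_hom "ev2 u v"
    by (rule ev.unital_hom_ev)
  have "x + y \<in> E \<and> x * y \<in> E" if "x \<in> E" "y \<in> E" for x y
  proof -
    from that obtain P Q R S where
      x: "x = ev2 u v P / ev2 u v Q" "ev2 u v Q \<noteq> 0" and
      y: "y = ev2 u v R / ev2 u v S" "ev2 u v S \<noteq> 0"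
      by (auto elim!: E_cases)
    then have "x + y = ev2 u v (P * S + R * Q) / ev2 u v (Q * S)"
      and "x * y = ev2 u v (P * R) / ev2 u v (Q * S)"
      by (simp_all add: e.hom_add e.hom_mult add_frac_eq)
    moreover have "ev2 u v (Q * S) \<noteq> 0"
      by (simp add: x y e.hom_mult)
    ultimately show ?thesis
      using frac_in_E by metis
  qed
  moreover have "- x \<in> E \<and> inverse x \<in> E" if "x \<in> E" for x
  proof -
    from that obtain P Q where x: "x = ev2 u v P / ev2 u v Q" "ev2 u v Q \<noteq> 0"
      by (rule E_cases)
    have "- x = ev2 u v (- P) / ev2 u v Q"
      by (simp add: x e.hom_uminus)
    \<comment> \<open>Closure is demanded at \<open>0\<close> too, where
      \<open>inverse 0 = 0\<close>; in that case \<open>P\<close> cannot serve as a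
      denominator.\<close>
    moreover have "inverse x \<in> E"
    proof (cases "ev2 u v P = 0")
      case True
      then show ?thesis
        using ev2_in_E[of 0] by (simp add: x)
    next
      case False
      then show ?thesis
        using frac_in_E[of P Q] by (simp add: x)
    qed
    ultimately show ?thesis
      using frac_in_E x(2) by metis
  qed
  ultimately show ?thesis
    using ev2_in_E[of 0] ev2_in_E[of 1] by (simp add: is_subfield_def)
qed

lemma E_minimal:
  assumes "is_subfield S" "range \<iota> \<subseteq> S" "u \<in> S" "v \<in> S"
  shows "E \<subseteq> S"
proof -
  note S = is_subfieldD[OF assms(1)]
  have "ev u p \<in> S" for p
    using assms(2-3) by (intro ev_in_subring) (auto intro: S)
  then have "ev2 u v P \<in> S" for P
    using assms(4) by (intro ev.ev_in_subring) (auto intro: S)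
  then show ?thesis
    by (auto elim!: E_cases intro: S)
qed

lemma lin_in_E: "lin a b \<in> E"
  unfolding lin_def using is_subfieldD[OF is_subfield_E] \<iota>_in_E u_in_E v_in_E by auto

lemma T_in_E: "T \<in> E"
proof -
  have "T = - (u ^ (q ^ 2) + u) / u ^ q"
    using L_u u_nonzero by (simp add: L_def field_simps eq_neg_iff_add_eq_0)
  moreover have "- (u ^ (q ^ 2) + u) / u ^ q \<in> E"
    by (intro is_subfieldD[OF is_subfield_E] u_in_E)
  ultimately show ?thesis
    by (simp only:)
qed

lemma E_good:
  assumes "good x y"
  shows "dickson_basis.E \<iota> x y = E"
proof
  interpret B: dickson_basis \<iota> q T x y
    by unfold_locales fact
  show "B.E \<subseteq> E"
  proof (rule B.E_minimal[OF is_subfield_E])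
    show "range \<iota> \<subseteq> E"
      using \<iota>_in_E by blast
    show "x \<in> E" "y \<in> E"
      using assms lin_in_E by (auto simp: good_iff)
  qed
  show "E \<subseteq> B.E"
  proof (rule E_minimal[OF B.is_subfield_E])
    show "range \<iota> \<subseteq> B.E"
      using B.\<iota>_in_E by blast
    \<comment> \<open>Goodness of \<open>u\<close>, \<open>v\<close> is now expressed in the basis
      \<open>x\<close>, \<open>y\<close>.\<close>
    show "u \<in> B.E" "v \<in> B.E"
      using good B.lin_in_E unfolding B.good_iff by blast+
  qed
qed

section \<open>Automorphisms as substitutions\<close>

text \<open>The carrier of the Galois group, except that fixing the base field is reduced to fixing
  its generators: the finite field and \<open>T\<close>.\<close>

definition autos :: "('k \<Rightarrow> 'k) set" where
  "autos = {\<sigma>. bij_betw \<sigma> E E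
     \<and> (\<forall>x\<in>E. \<forall>y\<in>E. \<sigma> (x + y) = \<sigma> x + \<sigma> y \<and> \<sigma> (x * y) = \<sigma> x * \<sigma> y)
     \<and> \<sigma> 1 = 1 \<and> (\<forall>a. \<sigma> (\<iota> a) = \<iota> a) \<and> \<sigma> T = T
     \<and> (\<forall>x. x \<notin> E \<longrightarrow> \<sigma> x = undefined)}"

text \<open>The \<open>THE\<close> is well defined when \<open>good u' v'\<close>, since then every relation between \<open>u\<close> and \<open>v\<close>
  also holds between \<open>u'\<close> and \<open>v'\<close>.\<close>

definition subst :: "'k \<Rightarrow> 'k \<Rightarrow> 'k \<Rightarrow> 'k" where
  "subst u' v' x = (if x \<in> E then
     (THE y. \<exists>P Q. ev2 u v Q \<noteq> 0 \<and> x = ev2 u v P / ev2 u v Q \<and> y = ev2 u' v' P / ev2 u' v' Q)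
   else undefined)"

text \<open>If two fractions agree at \<open>u\<close>, \<open>v\<close>, the cross difference
  \<open>P * Q' - P' * Q\<close> is a relation and so transfers to \<open>u'\<close>,
  \<open>v'\<close>. Transfer in the reverse direction keeps denominators nonzero.\<close>

lemma subst_frac:
  assumes "good u' v'" "ev2 u v Q \<noteq> 0"
  shows "subst u' v' (ev2 u v P / ev2 u v Q) = ev2 u' v' P / ev2 u' v' Q"
proof -
  interpret e: unital_hom "ev2 u v" by (rule ev.unital_hom_ev)
  interpret e': unital_hom "ev2 u' v'" by (rule ev.unital_hom_ev)
  have nz: "ev2 u' v' R \<noteq> 0" if "ev2 u v R \<noteq> 0" for R
    using ev2_eq_0_transfer[OF assms(1) good] that by blast
  have "ev2 u' v' P / ev2 u' v' Q = ev2 u' v' P' / ev2 u' v' Q'"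
    if "ev2 u v Q' \<noteq> 0" "ev2 u v P / ev2 u v Q = ev2 u v P' / ev2 u v Q'" for P' Q'
  proof -
    have "ev2 u v (P * Q' - P' * Q) = 0"
      using that assms(2) by (simp add: e.hom_diff e.hom_mult frac_eq_eq)
    then have "ev2 u' v' (P * Q' - P' * Q) = 0"
      by (rule ev2_eq_0_transfer[OF good assms(1)])
    then show ?thesis
      using nz that assms(2) by (simp add: e'.hom_diff e'.hom_mult frac_eq_eq)
  qed
  then have "(THE y. \<exists>P' Q'. ev2 u v Q' \<noteq> 0 \<and> ev2 u v P / ev2 u v Q = ev2 u v P' / ev2 u v Q'
      \<and> y = ev2 u' v' P' / ev2 u' v' Q') = ev2 u' v' P / ev2 u' v' Q"
    using assms(2) by (intro the_equality) (blast, metis)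
  then show ?thesis
    using frac_in_E[OF assms(2)] by (simp add: subst_def)
qed

lemma subst_ev2:
  assumes "good u' v'"
  shows "subst u' v' (ev2 u v P) = ev2 u' v' P"
  using subst_frac[OF assms, of 1 P] by simp

lemma subst_u: "good u' v' \<Longrightarrow> subst u' v' u = u'"
  using subst_ev2[of u' v' "[:[:0, 1:]:]"] by simp

lemma subst_v: "good u' v' \<Longrightarrow> subst u' v' v = v'"
  using subst_ev2[of u' v' "[:0, 1:]"] by simp

lemma subst_\<iota>: "good u' v' \<Longrightarrow> subst u' v' (\<iota> a) = \<iota> a"
  using subst_ev2[of u' v' "[:[:a:]:]"] by simp

lemma subst_in_E:
  assumes "good u' v'" "x \<in> E"
  shows "subst u' v' x \<in> E"
proof -
  interpret B: dickson_basis \<iota> q T u' v'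
    by unfold_locales fact
  from assms(2) obtain P Q where x: "x = ev2 u v P / ev2 u v Q" "ev2 u v Q \<noteq> 0"
    by (rule E_cases)
  then have "ev2 u' v' Q \<noteq> 0"
    using ev2_eq_0_transfer[OF assms(1) good] by blast
  then have "subst u' v' x \<in> B.E"
    using x assms(1) by (simp add: subst_frac B.frac_in_E)
  then show ?thesis
    by (simp add: E_good[OF assms(1)])
qed

text \<open>Replacing \<open>u'\<close>, \<open>v'\<close> by \<open>u\<close>, \<open>v\<close>
  undoes the substitution; bijectivity rests on this.\<close>

lemma subst_inverse:
  assumes "good u' v'" "x \<in> E"
  shows "dickson_basis.subst \<iota> u' v' u v (subst u' v' x) = x"
proof -
  interpret B: dickson_basis \<iota> q T u' v'
    by unfold_locales fact
  from assms(2) obtain P Q where x: "x = ev2 u v P / ev2 u v Q" "ev2 u v Q \<noteq> 0"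
    by (rule E_cases)
  then have "ev2 u' v' Q \<noteq> 0"
    using ev2_eq_0_transfer[OF assms(1) good] by blast
  then show ?thesis
    using x assms(1) good by (simp add: subst_frac B.subst_frac)
qed

lemma subst_bij:
  assumes "good u' v'"
  shows "bij_betw (subst u' v') E E"
proof -
  interpret B: dickson_basis \<iota> q T u' v'
    by unfold_locales fact
  have [simp]: "B.E = E"
    by (rule E_good) fact
  show ?thesis
  proof (rule bij_betwI)
    show "subst u' v' \<in> E \<rightarrow> E"
      using subst_in_E assms by blast
    show "B.subst u v \<in> E \<rightarrow> E"
      using B.subst_in_E good by auto
  qed (use subst_inverse[OF assms] B.subst_inverse[OF good] in auto)
qed

lemma subst_hom:
  assumes "good u' v'" "x \<in> E" "y \<in> E"
  shows "subst u' v' (x + y) = subst u' v' x + subst u' v' y"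
    and "subst u' v' (x * y) = subst u' v' x * subst u' v' y"
proof -
  interpret e: unital_hom "ev2 u v" by (rule ev.unital_hom_ev)
  interpret e': unital_hom "ev2 u' v'" by (rule ev.unital_hom_ev)
  from assms obtain P Q R S where
    x: "x = ev2 u v P / ev2 u v Q" "ev2 u v Q \<noteq> 0" and
    y: "y = ev2 u v R / ev2 u v S" "ev2 u v S \<noteq> 0"
    by (auto elim!: E_cases)
  then have xy: "x + y = ev2 u v (P * S + R * Q) / ev2 u v (Q * S)"
      "x * y = ev2 u v (P * R) / ev2 u v (Q * S)"
    by (simp_all add: e.hom_add e.hom_mult add_frac_eq)
  have QS: "ev2 u v (Q * S) \<noteq> 0"
    by (simp add: x y e.hom_mult)
  have QS': "ev2 u' v' Q \<noteq> 0" "ev2 u' v' S \<noteq> 0"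
    using ev2_eq_0_transfer[OF assms(1) good] x y by blast+
  have "subst u' v' x = ev2 u' v' P / ev2 u' v' Q" "subst u' v' y = ev2 u' v' R / ev2 u' v' S"
    unfolding x(1) y(1) by (rule subst_frac[OF assms(1)], fact)+
  moreover have "subst u' v' (x + y) = ev2 u' v' (P * S + R * Q) / ev2 u' v' (Q * S)"
    "subst u' v' (x * y) = ev2 u' v' (P * R) / ev2 u' v' (Q * S)"
    unfolding xy by (rule subst_frac[OF assms(1) QS])+
  ultimately show "subst u' v' (x + y) = subst u' v' x + subst u' v' y"
    "subst u' v' (x * y) = subst u' v' x * subst u' v' y"
    using QS' by (simp_all add: e'.hom_add e'.hom_mult add_frac_eq)
qed

lemma hom_power_on_E:
  assumes "\<forall>x\<in>E. \<forall>y\<in>E. \<sigma> (x + y) = \<sigma> x + \<sigma> y \<and> \<sigma> (x * y) = \<sigma> x * \<sigma> y"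
    and "\<sigma> 1 = 1" "x \<in> E"
  shows "\<sigma> (x ^ n) = \<sigma> x ^ n"
  using assms is_subfieldD[OF is_subfield_E] by (induction n) auto

text \<open>\<open>\<sigma> T\<close> is left as it stands, since for substitutions
  \<open>\<sigma> T = T\<close> is to be deduced from this formula.\<close>

lemma hom_L_on_E:
  assumes "\<forall>x\<in>E. \<forall>y\<in>E. \<sigma> (x + y) = \<sigma> x + \<sigma> y \<and> \<sigma> (x * y) = \<sigma> x * \<sigma> y"
    and "\<sigma> 1 = 1" "x \<in> E"
  shows "\<sigma> (L x) = \<sigma> x ^ (q ^ 2) + \<sigma> T * \<sigma> x ^ q + \<sigma> x"
  using assms hom_power_on_E[OF assms] is_subfieldD[OF is_subfield_E] T_in_E
  by (simp add: L_def)

lemma subst_in_autos: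
  assumes "good u' v'"
  shows "subst u' v' \<in> autos"
proof -
  have 1: "subst u' v' 1 = 1" and 0: "subst u' v' 0 = 0"
    using subst_\<iota>[OF assms, of 1] subst_\<iota>[OF assms, of 0] by simp_all
  have "u' ^ (q ^ 2) + subst u' v' T * u' ^ q + u' = 0"
    using hom_L_on_E[where \<sigma> = "subst u' v'" and x = u] 0 1
    by (simp add: L_u subst_u subst_hom u_in_E assms)
  moreover have "u' ^ (q ^ 2) + T * u' ^ q + u' = 0" "u' \<noteq> 0"
    using assms by (simp_all add: good_def L_def)
  \<comment> \<open>Applying the substitution to \<open>L u = 0\<close> gives the equation of
    \<open>u'\<close> with the image of \<open>T\<close> as coefficient. As \<open>u'\<close> is
    itself a root of \<open>L\<close>, the two coefficients agree.\<close>
  ultimately have "subst u' v' T * u' ^ q = T * u' ^ q"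
    by (metis add_left_cancel add_right_cancel)
  with \<open>u' \<noteq> 0\<close> have "subst u' v' T = T"
    by simp
  with 1 show ?thesis
    by (auto simp: autos_def subst_bij subst_hom subst_\<iota> assms) (simp add: subst_def)
qed

context
  fixes \<sigma> assumes \<sigma>: "\<sigma> \<in> autos"
begin

lemma auto_simps:
  "x \<in> E \<Longrightarrow> y \<in> E \<Longrightarrow> \<sigma> (x + y) = \<sigma> x + \<sigma> y"
  "x \<in> E \<Longrightarrow> y \<in> E \<Longrightarrow> \<sigma> (x * y) = \<sigma> x * \<sigma> y"
  "\<sigma> 1 = 1" "\<sigma> (\<iota> a) = \<iota> a" "\<sigma> T = T" "x \<notin> E \<Longrightarrow> \<sigma> x = undefined"
  using \<sigma> by (auto simp: autos_def)

lemma auto_0: "\<sigma> 0 = 0"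
  using auto_simps(4)[of 0] by simp

lemma auto_bij: "bij_betw \<sigma> E E"
  using \<sigma> by (simp add: autos_def)

lemma auto_eq_0_iff: "x \<in> E \<Longrightarrow> \<sigma> x = 0 \<longleftrightarrow> x = 0"
  using auto_bij auto_0 is_subfieldD(1)[OF is_subfield_E]
  by (metis bij_betw_imp_inj_on inj_onD)

lemma auto_lin: "\<sigma> (lin a b) = \<iota> a * \<sigma> u + \<iota> b * \<sigma> v"
  unfolding lin_def using is_subfieldD[OF is_subfield_E] \<iota>_in_E u_in_E v_in_E
  by (simp add: auto_simps)

lemma auto_good: "good (\<sigma> u) (\<sigma> v)"
proof -
  note S = is_subfieldD[OF is_subfield_E]
  have "L (\<sigma> u) = \<sigma> (L u)"
    using hom_L_on_E[where \<sigma> = \<sigma> and x = u] by (simp add: auto_simps u_in_E L_def)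
  then have "L (\<sigma> u) = 0"
    by (simp add: L_u auto_0)
  moreover have "\<sigma> u \<noteq> 0"
    using auto_eq_0_iff u_in_E u_nonzero by blast
  moreover have "W (\<sigma> u) (\<sigma> v) = 1"
  proof -
    have pw: "\<sigma> (x ^ n) = \<sigma> x ^ n" if "x \<in> E" for x n
      using hom_power_on_E[where \<sigma> = \<sigma> and x = x] that by (simp add: auto_simps)
    \<comment> \<open>Rearranged without subtraction, because \<open>\<sigma>\<close> comes with
      rules for sums and products only.\<close>
    have "u * v ^ q = 1 + u ^ q * v"
      using W_u_v by (simp add: W_def diff_eq_eq)
    then have "\<sigma> (u * v ^ q) = \<sigma> (1 + u ^ q * v)"
      by simp
    then show ?thesis
      using S u_in_E v_in_E by (simp add: auto_simps pw W_def)
  qed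
  ultimately show ?thesis
    by (simp add: good_def)
qed

text \<open>Elements of \<open>E\<close> are fractions in \<open>u\<close> and \<open>v\<close>, so
  the images of these two determine \<open>\<sigma>\<close>.\<close>

lemma auto_eq_subst: "\<sigma> = subst (\<sigma> u) (\<sigma> v)"
proof
  fix x
  note S = is_subfieldD[OF is_subfield_E]
  have "\<sigma> (ev u p) = ev (\<sigma> u) p" for p
    by (rule ev_commute[where S = E])
      (auto intro: S u_in_E \<iota>_in_E unital_hom_axioms simp: auto_simps)
  moreover have "ev u p \<in> E" for p
    by (rule ev_in_subring) (auto intro: S u_in_E \<iota>_in_E)
  ultimately have *: "\<sigma> (ev2 u v P) = ev2 (\<sigma> u) (\<sigma> v) P" for P
    by (intro ev.ev_commute[where S = E])
      (auto intro: S v_in_E ev.unital_hom_axioms simp: auto_simps)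
  show "\<sigma> x = subst (\<sigma> u) (\<sigma> v) x"
  proof (cases "x \<in> E")
    case True
    then obtain P Q where x: "x = ev2 u v P / ev2 u v Q" "ev2 u v Q \<noteq> 0"
      by (rule E_cases)
    have Q: "\<sigma> (ev2 u v Q) \<noteq> 0"
      using x(2) auto_eq_0_iff ev2_in_E by blast
    have "x * ev2 u v Q = ev2 u v P"
      using x by simp
    then have "\<sigma> (ev2 u v P) = \<sigma> x * \<sigma> (ev2 u v Q)"
      using auto_simps(2)[OF True ev2_in_E, of Q] by simp
    then have "\<sigma> x = \<sigma> (ev2 u v P) / \<sigma> (ev2 u v Q)"
      using Q by simp
    moreover have "subst (\<sigma> u) (\<sigma> v) x = ev2 (\<sigma> u) (\<sigma> v) P / ev2 (\<sigma> u) (\<sigma> v) Q"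
      unfolding x(1) by (rule subst_frac[OF auto_good x(2)])
    ultimately show ?thesis
      by (simp add: *)
  qed (simp add: auto_simps subst_def)
qed

end

section \<open>Matrices of automorphisms\<close>

text \<open>Cramer's rule for the basis \<open>u\<close>, \<open>v\<close>, whose Moore determinant
  is \<open>1\<close>.\<close>

definition coord1 :: "'k \<Rightarrow> 'a" where "coord1 x = the_inv \<iota> (W x v)"
definition coord2 :: "'k \<Rightarrow> 'a" where "coord2 x = the_inv \<iota> (W u x)"

lemma coord_lin [simp]: "coord1 (lin a b) = a" "coord2 (lin a b) = b"
  by (simp_all add: coord1_def coord2_def W_lin_v W_u_lin the_inv_f_f inj_\<iota>)

text \<open>The columns are the coordinates of the images of \<open>u\<close> and \<open>v\<close>,
  so composition becomes the matrix product in the same order.\<close>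

definition mat_of :: "('k \<Rightarrow> 'k) \<Rightarrow> 'a ^ 2 ^ 2" where
  "mat_of \<sigma> = (\<chi> i j. (if i = 1 then coord1 else coord2) (\<sigma> (if j = 1 then u else v)))"

lemma mat_of_eq_iff:
  "mat_of \<sigma> = A \<longleftrightarrow> coord1 (\<sigma> u) = A $ 1 $ 1 \<and> coord1 (\<sigma> v) = A $ 1 $ 2
     \<and> coord2 (\<sigma> u) = A $ 2 $ 1 \<and> coord2 (\<sigma> v) = A $ 2 $ 2"
  by (auto simp: mat_of_def vec_eq_iff forall_2)

lemma auto_columns:
  assumes "\<sigma> \<in> autos"
  shows "\<sigma> u = lin (mat_of \<sigma> $ 1 $ 1) (mat_of \<sigma> $ 2 $ 1)"
    and "\<sigma> v = lin (mat_of \<sigma> $ 1 $ 2) (mat_of \<sigma> $ 2 $ 2)"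
    and "det (mat_of \<sigma>) = 1"
proof -
  from auto_good[OF assms] obtain a b c d where
    *: "\<sigma> u = lin a b" "\<sigma> v = lin c d" "a * d - b * c = 1"
    unfolding good_iff by blast
  then show "\<sigma> u = lin (mat_of \<sigma> $ 1 $ 1) (mat_of \<sigma> $ 2 $ 1)"
    "\<sigma> v = lin (mat_of \<sigma> $ 1 $ 2) (mat_of \<sigma> $ 2 $ 2)" "det (mat_of \<sigma>) = 1"
    by (simp_all add: mat_of_def det_2 mult.commute)
qed

lemma mat_of_comp:
  assumes "\<sigma> \<in> autos" "\<tau> \<in> autos"
  shows "mat_of (restrict (\<sigma> \<circ> \<tau>) E) = mat_of \<sigma> ** mat_of \<tau>"
proof -
  have *: "\<sigma> (lin a b) = lin (mat_of \<sigma> $ 1 $ 1 * a + mat_of \<sigma> $ 1 $ 2 * b)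
      (mat_of \<sigma> $ 2 $ 1 * a + mat_of \<sigma> $ 2 $ 2 * b)" for a b
    unfolding auto_lin[OF assms(1)] auto_columns(1,2)[OF assms(1)]
    by (simp add: lin_def hom_add hom_mult algebra_simps)
  show ?thesis
    unfolding mat_of_eq_iff
    by (simp add: u_in_E v_in_E auto_columns(1,2)[OF assms(2)] * matrix_matrix_mult_def sum_2)
qed

text \<open>Injectivity holds because the columns determine the images of \<open>u\<close> and
  \<open>v\<close>. For surjectivity, the columns of a matrix of determinant \<open>1\<close> form a
  good pair, and substituting it realises the matrix.\<close>

lemma autos_iso_SL2:
  "\<lparr>carrier = autos, mult = (\<lambda>\<sigma> \<tau>. restrict (\<sigma> \<circ> \<tau>) E), one = restrict id E\<rparr>
     \<cong> (SL2 :: ('a ^ 2 ^ 2) monoid)"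
proof -
  have "inj_on mat_of autos"
  proof (rule inj_onI)
    fix \<sigma> \<tau> assume *: "\<sigma> \<in> autos" "\<tau> \<in> autos" "mat_of \<sigma> = mat_of \<tau>"
    then have "\<sigma> u = \<tau> u" "\<sigma> v = \<tau> v"
      using auto_columns by metis+
    then show "\<sigma> = \<tau>"
      using auto_eq_subst * by metis
  qed
  moreover have "mat_of ` autos = {A. det A = 1}"
  proof (intro equalityI subsetI)
    fix A :: "'a ^ 2 ^ 2" assume "A \<in> {A. det A = 1}"
    then have det: "A $ 1 $ 1 * A $ 2 $ 2 - A $ 2 $ 1 * A $ 1 $ 2 = 1"
      by (simp add: det_2 mult.commute)
    define x y where "x = lin (A $ 1 $ 1) (A $ 2 $ 1)" and "y = lin (A $ 1 $ 2) (A $ 2 $ 2)"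
    have xy: "good x y"
      unfolding good_iff x_def y_def using det by blast
    have "mat_of (subst x y) = A"
      unfolding mat_of_eq_iff by (simp add: subst_u[OF xy] subst_v[OF xy]) (simp add: x_def y_def)
    then show "A \<in> mat_of ` autos"
      using subst_in_autos[OF xy] by blast
  qed (auto simp: auto_columns)
  ultimately show ?thesis
    unfolding is_iso_def iso_def hom_def bij_betw_def SL2_def
    by (auto simp: mat_of_comp auto_columns(3) intro!: exI[of _ mat_of])
qed

end

section \<open>Existence of a basis and identification of the Galois group\<close>

text \<open>Algebraic closedness is used twice: for a root \<open>u\<close> of the given polynomial,
  then for a root \<open>v\<close> of the equation \<open>W u v = 1\<close> in
  \<open>v\<close>.\<close>

lemma dickson_basis_exists:
  fixes \<iota> :: "'a::{finite,field} \<Rightarrow> 'k::alg_closed_field"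
  assumes "dickson \<iota> q T"
  obtains u v where "dickson_basis \<iota> q T u v"
proof -
  interpret dickson \<iota> q T by fact
  have q: "q \<ge> 2" by (rule q_ge_2)
  have "q < q ^ 2"
    using q by (simp add: power2_eq_square)
  with q have q': "q - 1 < q ^ 2 - 1" "q - 1 > 0" by linarith+
  define p1 where "p1 = monom 1 (q ^ 2 - 1) + monom T (q - 1) + (1 :: 'k poly)"
  have "coeff p1 (q ^ 2 - 1) = 1"
    using q' by (simp add: p1_def)
  then have "degree p1 > 0"
    using q' by (metis le_degree less_le_trans gr_implies_not_zero less_trans zero_neq_one)
  then obtain u where u: "poly p1 u = 0"
    using alg_closed_imp_poly_has_root by blast
  have "u \<noteq> 0"
    using u q' by (auto simp: p1_def poly_monom power_0_left split: if_splits)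
  then have "L u = 0"
    using u root_iff by (simp add: p1_def poly_monom)
  define p2 where "p2 = monom u q - monom (u ^ q) 1 - 1"
  have "coeff p2 q = u"
    using q by (simp add: p2_def)
  then have "degree p2 > 0"
    using q \<open>u \<noteq> 0\<close> by (metis le_degree less_le_trans zero_less_numeral)
  then obtain v where "poly p2 v = 0"
    using alg_closed_imp_poly_has_root by blast
  then have "good u v"
    using \<open>u \<noteq> 0\<close> \<open>L u = 0\<close> by (simp add: good_def p2_def poly_monom W_def)
  then show ?thesis
    by (intro that[of u v]) unfold_locales
qed

theorem theorem7p2:
  fixes q :: nat and t :: "'a::{finite,field} poly fract"
    and f :: "'a poly fract poly"
  assumes "q = CARD('a)"
    and "t = Fract [:0, 1:] 1"
    and "f = monom 1 (q^2 - 1) + smult t (monom 1 (q - 1)) + 1"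
  shows "galois_group f \<cong> (SL2 :: ('a ^ 2 ^ 2) monoid)"
proof -
  define \<iota> :: "'a \<Rightarrow> 'a poly fract alg_closure" where "\<iota> a = to_ac (Fract [:a:] 1)" for a
  define T where "T = to_ac t"
  interpret finite_field_extension \<iota> q
    using assms(1) by unfold_locales
      (simp_all add: \<iota>_def One_fract_def one_pCons mult.commute flip: to_ac_add to_ac_mult to_ac_1)
  \<comment> \<open>Since \<open>t\<close> is the class of the variable, evaluation at
    \<open>T\<close> is the embedding of polynomials; transcendence of \<open>T\<close>
    follows.\<close>
  have ev_T: "ev T p = to_ac (Fract p 1)" for p
  proof (induction p)
    case (pCons a p)
    have "Fract (pCons a p) 1 = Fract [:a:] 1 + t * Fract p 1"
      by (simp add: assms(2))
    then show ?case
      unfolding ev_pCons pCons.IH by (simp add: T_def \<iota>_def)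
  qed (simp add: Zero_fract_def[symmetric])
  interpret dickson \<iota> q T
    by unfold_locales (simp add: ev_T Zero_fract_def eq_fract)
  obtain u v where "dickson_basis \<iota> q T u v"
    using dickson_basis_exists dickson_axioms by blast
  then interpret dickson_basis \<iota> q T u v .
  have to_ac_frac: "to_ac (Fract a b) = ev T a / ev T b" if "b \<noteq> 0" for a b
    using that by (simp add: ev_T flip: to_ac_divide)
  note S = is_subfieldD[OF is_subfield_E]
  have roots: "roots_ac f = {x. x \<noteq> 0 \<and> L x = 0}"
  proof -
    have "map_poly to_ac f = monom 1 (q ^ 2 - 1) + monom T (q - 1) + 1"
      unfolding assms(3) T_def
      by (intro poly_eqI) (simp add: coeff_map_poly)
    \<comment> \<open>Both exponents are positive because \<open>q\<close> is at least
      \<open>2\<close>, so only the constant term survives at \<open>0\<close>.\<close>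
    moreover have "0 ^ (q ^ 2 - 1) + T * 0 ^ (q - 1) + 1 \<noteq> 0"
    proof -
      have "q < q ^ 2"
        using q_ge_2 by (simp add: power2_eq_square)
      with q_ge_2 show ?thesis
        by (simp add: power_0_left)
    qed
    ultimately have "x \<in> roots_ac f \<longleftrightarrow> x \<noteq> 0 \<and> L x = 0" for x
      using root_iff[of x] by (cases "x = 0") (simp_all add: roots_ac_def poly_monom)
    then show ?thesis
      by blast
  qed
  have to_ac_in_E: "to_ac a \<in> E" for a
  proof (cases a)
    case (Fract b c)
    have "ev T p \<in> E" for p
      by (rule ev_in_subring) (auto intro: S \<iota>_in_E T_in_E)
    with Fract show ?thesis
      by (auto simp: to_ac_frac intro: S)
  qed
  have E: "splitting_field_ac f = E"
    unfolding splitting_field_ac_def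
  proof (intro equalityI Inter_greatest Inter_lower CollectI conjI)
    show "is_subfield E" by (rule is_subfield_E)
    show "range to_ac \<subseteq> E" using to_ac_in_E by blast
    show "roots_ac f \<subseteq> E"
      using lin_in_E by (auto simp: roots L_eq_0_iff)
  next
    fix S assume *: "S \<in> {S. is_subfield S \<and> range to_ac \<subseteq> S \<and> roots_ac f \<subseteq> S}"
    have "v \<noteq> 0"
      using W_u_v q_ge_2 by (auto simp: W_def power_0_left)
    moreover have "L v = 0"
      using lin_0_1 L_eq_0_iff by metis
    ultimately show "E \<subseteq> S"
      using * L_u u_nonzero by (intro E_minimal) (auto simp: roots \<iota>_def)
  qed
  \<comment> \<open>Reconciles the two descriptions of the carrier: each base field element is a
    quotient of polynomials in \<open>T\<close> over the finite field.\<close>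
  have fixes_base: "(\<forall>a. \<sigma> (to_ac a) = to_ac a) \<longleftrightarrow> (\<forall>a. \<sigma> (\<iota> a) = \<iota> a) \<and> \<sigma> T = T"
    if \<sigma>: "\<forall>x\<in>E. \<forall>y\<in>E. \<sigma> (x + y) = \<sigma> x + \<sigma> y \<and> \<sigma> (x * y) = \<sigma> x * \<sigma> y" for \<sigma>
  proof (intro iffI allI)
    fix a :: "'a poly fract" assume *: "(\<forall>a. \<sigma> (\<iota> a) = \<iota> a) \<and> \<sigma> T = T"
    obtain b c where a: "a = Fract b c" "c \<noteq> 0"
      by (cases a) auto
    have ev_in: "ev T p \<in> E" for p
      by (rule ev_in_subring) (auto intro: S \<iota>_in_E T_in_E)
    have ev_fix: "\<sigma> (ev T p) = ev T p" for p
      using ev_commute[of \<iota> \<sigma> E T p] * \<sigma> S T_in_E \<iota>_in_E unital_hom_axioms by simp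
    have c: "ev T c \<noteq> 0"
      using a(2) transcendental_T by blast
    have "\<sigma> (to_ac a * ev T c) = \<sigma> (to_ac a) * \<sigma> (ev T c)"
      using \<sigma> to_ac_in_E ev_in by blast
    moreover have "to_ac a * ev T c = ev T b"
      using a c by (simp add: to_ac_frac)
    ultimately have "\<sigma> (to_ac a) * ev T c = to_ac a * ev T c"
      by (metis ev_fix)
    then show "\<sigma> (to_ac a) = to_ac a"
      using c by simp
  qed (simp add: \<iota>_def T_def)
  have "galois_group f = \<lparr>carrier = autos, mult = (\<lambda>\<sigma> \<tau>. restrict (\<sigma> \<circ> \<tau>) E), one = restrict id E\<rparr>"
    unfolding galois_group_def E Let_def autos_def using fixes_base by auto
  then show ?thesis
    using autos_iso_SL2 by simp
qed

end
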